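(* $v_w(\delta)$ is approximated by the (global) solution to the following nonlinear program, called N_WNA, in which $M$ is a large positive constant ("big M") and $\epsilon$ is a small positive constant: $$v_w(\delta)=\max_{w\in\mathbb R^n}\ \min_{\lambda_k:\ k\in\{0,1,\dots,N\}}\ F_k(w):=\lambda_k\delta+\frac1N\Big[\sum_{i=1}^N\mathbf 1_{\{w\cdot s_i\ge0\}}+\sum_{i=1}^N z_i^+\,\mathbf 1_{\{w\cdot s_i<0\}}\Big]$$ subject to $c_i=\dfrac{|w^\top s_i|}{\|w\|_2}$ for $i\in\{1,\dots,N\}$; $\ \lambda_k=\dfrac1{c_k}$ for all $k\in\{1,\dots,N\}$; $\ \lambda_0=0$; $\ |w_j|\le M$ for $j\in\{1,\dots,n\}$; $\ w\cdot S_0=0$; $\ \sum_{j=1}^n|w_j|\ge\epsilon$; $\ z_i=1-\lambda_kc_i$ for $i\in\{1,\dots,N\}$.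
   Context: $S_0\in\mathbb R^n$ is the vector of initial asset prices, $s_1,\dots,s_N\in\mathbb R^n$ are the given time-1 asset price vectors (the support points of the empirical measure), and $\delta$ is the radius of a Wasserstein ball around the empirical measure. Write $x^+=[x]^+=\max(x,0)$. The set of admissible portfolios for the weak condition is $\Gamma_w=\{w\in\mathbb R^n: w\cdot S_0=0,\ w\neq0\}$. For $w\ne0$ and $\lambda\ge0$ put $c_i=|w^\top s_i|/\|w\|_2$, $K_0(w)=\frac1N\sum_{i=1}^N\mathbf 1_{\{w\cdot s_i\ge0\}}$, $K_1(\lambda,w)=\frac1N\sum_{i=1}^N\mathbf 1_{\{w\cdot s_i<0\}}[1-\lambda c_i]^+$, and let $\lambda^*(w,\delta)$ be a minimizer over $\lambda\ge0$ of the convex function $\lambda\mapsto\lambda\delta+K_0(w)+K_1(\lambda,w)$. Then $$v_w(\delta):=\sup_{w\in\Gamma_w}\{\lambda^*(w,\delta)\,\delta+K_0(w)+K_1(\lambda^*(w,\delta),w)\}.$$ The objective is unchanged when $w$ is replaced by $cw$ with $c>0$, which is why a "big M" bound is used to express $w\in\Gamma_w$. *)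

theory Defs
  imports "HOL-Analysis.Analysis"
begin

text \<open>
  Throughout, \<open>s 1, \<dots>, s N\<close> are the time-1 price vectors (values of \<open>s\<close> outside \<open>{1..N}\<close> are
  never used), \<open>S\<^sub>0\<close> is the initial price vector and \<open>\<delta>\<close> is the Wasserstein radius.
\<close>

definition Gamma_w :: "real ^ 'n \<Rightarrow> (real ^ 'n) set" where
  "Gamma_w S\<^sub>0 = {w. w \<bullet> S\<^sub>0 = 0 \<and> w \<noteq> 0}"

definition cost :: "(nat \<Rightarrow> real ^ 'n) \<Rightarrow> real ^ 'n \<Rightarrow> nat \<Rightarrow> real" where
  "cost s w i = \<bar>w \<bullet> s i\<bar> / norm w"

definition K0 :: "nat \<Rightarrow> (nat \<Rightarrow> real ^ 'n) \<Rightarrow> real ^ 'n \<Rightarrow> real" where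
  "K0 N s w = 1 / real N * (\<Sum>i=1..N. of_bool (w \<bullet> s i \<ge> 0))"

definition K1 :: "nat \<Rightarrow> (nat \<Rightarrow> real ^ 'n) \<Rightarrow> real \<Rightarrow> real ^ 'n \<Rightarrow> real" where
  "K1 N s l w = 1 / real N * (\<Sum>i=1..N. of_bool (w \<bullet> s i < 0) * max (1 - l * cost s w i) 0)"

definition dual_objective ::
    "nat \<Rightarrow> (nat \<Rightarrow> real ^ 'n) \<Rightarrow> real \<Rightarrow> real ^ 'n \<Rightarrow> real \<Rightarrow> real" where
  "dual_objective N s \<delta> w l = l * \<delta> + K0 N s w + K1 N s l w"

definition lambda_star :: "nat \<Rightarrow> (nat \<Rightarrow> real ^ 'n) \<Rightarrow> real ^ 'n \<Rightarrow> real \<Rightarrow> real" where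
  "lambda_star N s w \<delta> = arg_min_on (dual_objective N s \<delta> w) {0..}"

text \<open>The supremum is taken in the extended reals, so it is \<open>-\<infinity>\<close> when no portfolio is admissible.\<close>

definition v_w :: "nat \<Rightarrow> (nat \<Rightarrow> real ^ 'n) \<Rightarrow> real ^ 'n \<Rightarrow> real \<Rightarrow> ereal" where
  "v_w N s S\<^sub>0 \<delta> =
    (SUP w \<in> Gamma_w S\<^sub>0.
      ereal (lambda_star N s w \<delta> * \<delta> + K0 N s w + K1 N s (lambda_star N s w \<delta>) w))"

definition nlp_lambda :: "(nat \<Rightarrow> real ^ 'n) \<Rightarrow> real ^ 'n \<Rightarrow> nat \<Rightarrow> real" where
  "nlp_lambda s w k = (if k = 0 then 0 else 1 / cost s w k)"

definition nlp_z :: "(nat \<Rightarrow> real ^ 'n) \<Rightarrow> real ^ 'n \<Rightarrow> nat \<Rightarrow> nat \<Rightarrow> real" where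
  "nlp_z s w k i = 1 - nlp_lambda s w k * cost s w i"

definition nlp_F :: "nat \<Rightarrow> (nat \<Rightarrow> real ^ 'n) \<Rightarrow> real \<Rightarrow> nat \<Rightarrow> real ^ 'n \<Rightarrow> real" where
  "nlp_F N s \<delta> k w =
    nlp_lambda s w k * \<delta> +
    1 / real N * ((\<Sum>i=1..N. of_bool (w \<bullet> s i \<ge> 0)) +
                  (\<Sum>i=1..N. max (nlp_z s w k i) 0 * of_bool (w \<bullet> s i < 0)))"

text \<open>
  An index \<open>k \<ge> 1\<close> with \<open>c\<^sub>k = 0\<close> has \<open>\<lambda>\<^sub>k = 1 / c\<^sub>k = +\<infinity>\<close> and is not a candidate in the inner
  minimum; it is left out explicitly instead of relying on \<open>1 / 0 = 0\<close>.
\<close>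

definition nlp_indices :: "nat \<Rightarrow> (nat \<Rightarrow> real ^ 'n) \<Rightarrow> real ^ 'n \<Rightarrow> nat set" where
  "nlp_indices N s w = {k \<in> {0..N}. k = 0 \<or> cost s w k \<noteq> 0}"

definition nlp_objective :: "nat \<Rightarrow> (nat \<Rightarrow> real ^ 'n) \<Rightarrow> real \<Rightarrow> real ^ 'n \<Rightarrow> real" where
  "nlp_objective N s \<delta> w = (MIN k \<in> nlp_indices N s w. nlp_F N s \<delta> k w)"

definition nlp_feasible :: "real ^ 'n \<Rightarrow> real \<Rightarrow> real \<Rightarrow> (real ^ 'n) set" where
  "nlp_feasible S\<^sub>0 M \<epsilon> =
    {w. (\<forall>j. \<bar>w $ j\<bar> \<le> M) \<and> w \<bullet> S\<^sub>0 = 0 \<and> (\<Sum>j\<in>UNIV. \<bar>w $ j\<bar>) \<ge> \<epsilon>}"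

end

theory Submission
  imports Defs
begin

text \<open>
  For a fixed portfolio the dual objective is piecewise linear in \<open>\<lambda>\<close>, with kinks only at the
  points \<open>1 / c\<^sub>i\<close>, so its minimum over \<open>\<lambda> \<ge> 0\<close> is attained at one of the candidates \<open>\<lambda>\<^sub>k\<close>; hence the
  inner minimum of the program is the dual value. This value is invariant under positive scaling
  of the portfolio, and scaling to \<open>\<ell>\<^sub>1\<close>-norm \<open>\<epsilon>\<close> moves every admissible portfolio into the feasible
  set. The maximum is attained because the feasible set is compact and avoids \<open>0\<close>, and the dual
  value, as an infimum over \<open>\<lambda>\<close> of functions continuous in \<open>w \<noteq> 0\<close>, is upper semicontinuous.
\<close>

text \<open>From \<open>l\<close> one slides along the current affine piece, in the direction in
  which it does not increase, until a kink is met. Leftward, 0 counts as a kink; rightward, a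
  negative slope with \<open>d \<ge> 0\<close> forces some positive part to be still decreasing, so
  a kink lies ahead.\<close>

lemma piecewise_linear_min_at_kink:
  fixes c p :: "'i \<Rightarrow> real"
  assumes fin: "finite I" and p: "\<And>i. i \<in> I \<Longrightarrow> p i \<ge> 0" and c: "\<And>i. i \<in> I \<Longrightarrow> c i \<ge> 0"
    and d: "d \<ge> 0" and l: "l \<ge> 0"
  shows "\<exists>m \<in> insert 0 ((\<lambda>i. 1 / c i) ` {i \<in> I. c i \<noteq> 0}).
    m * d + (\<Sum>i\<in>I. p i * max (1 - m * c i) 0) \<le> l * d + (\<Sum>i\<in>I. p i * max (1 - l * c i) 0)"
proof -
  define kinks where "kinks = insert 0 ((\<lambda>i. 1 / c i) ` {i \<in> I. c i \<noteq> 0})"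
  \<comment> \<open>\<open>J\<close> collects the positive parts that are strictly active at
    \<open>l\<close>. The affine function \<open>h\<close> freezes this pattern and agrees with
    \<open>g\<close> until some term changes sign.\<close>
  define J where "J = {i \<in> I. l * c i < 1}"
  define g where "g m = m * d + (\<Sum>i\<in>I. p i * max (1 - m * c i) 0)" for m
  define h where "h m = m * (d - (\<Sum>i\<in>J. p i * c i)) + (\<Sum>i\<in>J. p i)" for m
  have fin_kinks: "finite kinks" using fin by (simp add: kinks_def)
  have finJ: "finite J" using fin by (simp add: J_def)
  have g_eq_h: "g m = h m"
    if "\<And>i. i \<in> J \<Longrightarrow> m * c i \<le> 1" and "\<And>i. i \<in> I - J \<Longrightarrow> m * c i \<ge> 1" for m
  proof -
    have "(\<Sum>i\<in>I. p i * max (1 - m * c i) 0) = (\<Sum>i\<in>J. p i * max (1 - m * c i) 0)"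
      by (rule sum.mono_neutral_right) (use fin that(2) in \<open>auto simp: J_def\<close>)
    also have "\<dots> = (\<Sum>i\<in>J. p i - m * (p i * c i))"
    proof (rule sum.cong)
      fix i assume "i \<in> J"
      hence "max (1 - m * c i) 0 = 1 - m * c i" using that(1) by simp
      thus "p i * max (1 - m * c i) 0 = p i - m * (p i * c i)" by (simp add: algebra_simps)
    qed simp
    finally show ?thesis
      by (simp add: g_def h_def sum_subtractf sum_distrib_left algebra_simps)
  qed
  have gl: "g l = h l" by (rule g_eq_h) (auto simp: J_def)
  have "\<exists>m\<in>kinks. g m \<le> g l"
  proof (cases "d - (\<Sum>i\<in>J. p i * c i) \<ge> 0")
    case True
    \<comment> \<open>Nearest kink at or to the left of \<open>l\<close>. A term outside
      \<open>J\<close> has its own kink at most \<open>l\<close>, hence at most \<open>a\<close>, so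
      it is still inactive at \<open>a\<close>.\<close>
    define a where "a = Max {m \<in> kinks. m \<le> l}"
    have "0 \<in> {m \<in> kinks. m \<le> l}" using l by (simp add: kinks_def)
    hence a: "a \<in> {m \<in> kinks. m \<le> l}"
      unfolding a_def by (intro Max_in) (use fin_kinks in auto)
    have "g a = h a"
    proof (rule g_eq_h)
      fix i assume i: "i \<in> J"
      have "a * c i \<le> l * c i" using a c i by (intro mult_right_mono) (auto simp: J_def)
      thus "a * c i \<le> 1" using i by (simp add: J_def)
    next
      fix i assume i: "i \<in> I - J"
      hence lc: "l * c i \<ge> 1" by (auto simp: J_def)
      hence "c i > 0" using c[of i] i by (cases "c i = 0") auto
      hence "1 / c i \<in> {m \<in> kinks. m \<le> l}" using i lc by (auto simp: kinks_def field_simps)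
      hence "1 / c i \<le> a" unfolding a_def using fin_kinks by (intro Max_ge) auto
      thus "a * c i \<ge> 1" using \<open>c i > 0\<close> by (simp add: field_simps)
    qed
    moreover have "h a \<le> h l" using a True by (simp add: h_def mult_right_mono)
    ultimately show ?thesis using a gl by (intro bexI[of _ a]) auto
  next
    case False
    \<comment> \<open>Terms outside \<open>J\<close> have their kinks at or before \<open>l\<close>,
      so the first kink beyond \<open>l\<close> comes from \<open>J\<close>.\<close>
    define B where "B = (\<lambda>i. 1 / c i) ` {i \<in> J. c i \<noteq> 0}"
    define b where "b = Min B"
    have "B \<noteq> {}"
    proof
      assume "B = {}"
      hence "(\<Sum>i\<in>J. p i * c i) = 0" by (intro sum.neutral) (auto simp: B_def)
      with False d show False by simp
    qed
    hence b: "b \<in> B" unfolding b_def by (intro Min_in) (use finJ in \<open>auto simp: B_def\<close>)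
    obtain i where "i \<in> J" "c i \<noteq> 0" and b_eq: "b = 1 / c i" using b by (auto simp: B_def)
    hence "c i > 0" "l * c i < 1" using c[of i] by (auto simp: J_def)
    hence "l \<le> b" by (simp add: b_eq pos_le_divide_eq)
    have "g b = h b"
    proof (rule g_eq_h)
      fix i assume i: "i \<in> J"
      show "b * c i \<le> 1"
      proof (cases "c i = 0")
        case nz: False
        hence "b \<le> 1 / c i" unfolding b_def
          by (intro Min_le) (use finJ i in \<open>auto simp: B_def\<close>)
        moreover have "c i > 0" using nz c[of i] i by (auto simp: J_def)
        ultimately show ?thesis by (simp add: field_simps)
      qed simp
    next
      fix i assume i: "i \<in> I - J"
      hence "1 \<le> l * c i" by (auto simp: J_def)
      also have "\<dots> \<le> b * c i" using \<open>l \<le> b\<close> c i by (intro mult_right_mono) auto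
      finally show "b * c i \<ge> 1" .
    qed
    moreover have "h b \<le> h l"
      using \<open>l \<le> b\<close> False by (simp add: h_def mult_right_mono_neg)
    moreover have "b \<in> kinks" using b by (auto simp: B_def kinks_def J_def)
    ultimately show ?thesis using gl by (intro bexI[of _ b]) auto
  qed
  thus ?thesis by (simp only: kinks_def g_def)
qed

text \<open>An upper semicontinuous function on a compact set attains its maximum. Without a
  maximum, the relatively open sets where \<open>f l\<close> lies below \<open>g y\<close> would
  cover \<open>K\<close>; in a finite subcover, the \<open>y\<close> with the largest
  \<open>g y\<close> cannot itself be covered.\<close>

lemma pointwise_min_attains_max:
  fixes f :: "'l \<Rightarrow> 'a::topological_space \<Rightarrow> real"
  assumes K: "compact K" "K \<noteq> {}"
    and cont: "\<And>l. l \<in> L \<Longrightarrow> continuous_on K (f l)"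
    and le: "\<And>l x. l \<in> L \<Longrightarrow> x \<in> K \<Longrightarrow> g x \<le> f l x"
    and att: "\<And>x. x \<in> K \<Longrightarrow> \<exists>l\<in>L. g x = f l x"
  shows "\<exists>x\<in>K. \<forall>y\<in>K. g y \<le> g x"
proof (rule ccontr)
  assume "\<not> ?thesis"
  hence no_max: "\<exists>y\<in>K. g x < g y" if "x \<in> K" for x using that by (meson not_le)
  have "\<exists>A. open A \<and> A \<inter> K = f l -` {..<g y} \<inter> K" if "l \<in> L" for l y
    using cont[OF that] by (simp add: continuous_on_open_invariant)
  then obtain U where U: "\<And>l y. l \<in> L \<Longrightarrow> open (U l y) \<and> U l y \<inter> K = f l -` {..<g y} \<inter> K"
    by metis
  have "K \<subseteq> (\<Union>q\<in>L \<times> K. U (fst q) (snd q))"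
  proof
    fix x assume x: "x \<in> K"
    obtain y where y: "y \<in> K" "g x < g y" using no_max[OF x] by blast
    obtain l where l: "l \<in> L" "g x = f l x" using att[OF x] by blast
    have "x \<in> U l y" using U[OF l(1), of y] x y l by auto
    thus "x \<in> (\<Union>q\<in>L \<times> K. U (fst q) (snd q))" using l y by force
  qed
  then obtain C where C: "C \<subseteq> L \<times> K" "finite C" "K \<subseteq> (\<Union>q\<in>C. U (fst q) (snd q))"
  proof (rule compactE_image[OF K(1), rotated])
    fix q assume "q \<in> L \<times> K"
    thus "open (U (fst q) (snd q))" using U by auto
  qed
  have "C \<noteq> {}" using C K by auto
  then obtain q where "q \<in> C" "g (snd q) = Max ((\<lambda>r. g (snd r)) ` C)"
    using obtains_MAX[OF C(2)] by metis
  hence q: "q \<in> C" "\<And>r. r \<in> C \<Longrightarrow> g (snd r) \<le> g (snd q)" using C(2) by auto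
  have x: "snd q \<in> K" using q C by auto
  then obtain r where r: "r \<in> C" "snd q \<in> U (fst r) (snd r)" using C by blast
  hence "fst r \<in> L" using C by auto
  hence "f (fst r) (snd q) < g (snd r)" using U[of "fst r" "snd r"] r x by auto
  thus False using le[OF \<open>fst r \<in> L\<close> x] q(2)[OF r(1)] by simp
qed

section \<open>The inner minimum as a dual value, and its dependence on the portfolio\<close>

lemma nlp_F_eq_dual_objective:
  "nlp_F N s \<delta> k w = dual_objective N s \<delta> w (nlp_lambda s w k)"
  by (simp add: nlp_F_def dual_objective_def K0_def K1_def nlp_z_def algebra_simps)

lemma finite_nlp_indices: "finite (nlp_indices N s w)"
  by (simp add: nlp_indices_def)

lemma zero_in_nlp_indices: "0 \<in> nlp_indices N s w"
  by (simp add: nlp_indices_def)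

lemma nlp_lambda_nonneg: "nlp_lambda s w k \<ge> 0"
  by (simp add: nlp_lambda_def cost_def)

lemma nlp_objective_attained:
  "\<exists>l\<in>{0..}. nlp_objective N s \<delta> w = dual_objective N s \<delta> w l"
proof -
  have "nlp_objective N s \<delta> w \<in> (\<lambda>k. nlp_F N s \<delta> k w) ` nlp_indices N s w"
    unfolding nlp_objective_def
  proof (rule Min_in)
    show "(\<lambda>k. nlp_F N s \<delta> k w) ` nlp_indices N s w \<noteq> {}"
      using zero_in_nlp_indices[of N s w] by (metis image_is_empty empty_iff)
  qed (simp add: finite_nlp_indices)
  thus ?thesis using nlp_lambda_nonneg by (auto simp: nlp_F_eq_dual_objective)
qed

text \<open>With \<open>nlp_objective_attained\<close>, this makes the finite minimum the minimum
  over all \<open>l \<ge> 0\<close>. \<open>K0\<close> is constant in \<open>l\<close>, so the kink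
  lemma applies to the rest.\<close>

lemma nlp_objective_le_dual_objective:
  assumes "\<delta> \<ge> 0" "l \<ge> 0"
  shows "nlp_objective N s \<delta> w \<le> dual_objective N s \<delta> w l"
proof -
  define p :: "nat \<Rightarrow> real" where "p i = 1 / real N * of_bool (w \<bullet> s i < 0)" for i
  have dual: "dual_objective N s \<delta> w m
      = K0 N s w + (m * \<delta> + (\<Sum>i\<in>{1..N}. p i * max (1 - m * cost s w i) 0))" for m
    unfolding dual_objective_def K1_def p_def sum_distrib_left mult.assoc by (simp only: ac_simps)
  have "p i \<ge> 0" "cost s w i \<ge> 0" for i by (simp_all add: p_def cost_def)
  then obtain m where m: "m \<in> insert 0 ((\<lambda>i. 1 / cost s w i) ` {i \<in> {1..N}. cost s w i \<noteq> 0})"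
      "dual_objective N s \<delta> w m \<le> dual_objective N s \<delta> w l"
    using piecewise_linear_min_at_kink[of "{1..N}" p "cost s w" \<delta> l] assms
    unfolding dual add_le_cancel_left by blast
  \<comment> \<open>The kink 0 is the index 0; any other kink comes from some
    \<open>i \<ge> 1\<close> of nonzero cost, which is exactly what \<open>nlp_indices\<close>
    admits.\<close>
  obtain k where k: "k \<in> nlp_indices N s w" "m = nlp_lambda s w k"
  proof (cases "m = 0")
    case True
    thus ?thesis using that[of 0] by (simp add: nlp_lambda_def zero_in_nlp_indices)
  next
    case False
    then obtain i where "i \<in> {1..N}" "cost s w i \<noteq> 0" "m = 1 / cost s w i" using m(1) by auto
    thus ?thesis using that[of i] by (auto simp: nlp_lambda_def nlp_indices_def)
  qed
  have "nlp_objective N s \<delta> w \<le> nlp_F N s \<delta> k w"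
    unfolding nlp_objective_def using k finite_nlp_indices by (intro Min_le) auto
  thus ?thesis using m k by (simp add: nlp_F_eq_dual_objective)
qed

text \<open>\<open>lambda_star\<close> is a Hilbert choice, so its minimality has to be derived from
  the existence of a minimizer, supplied by the finite minimum.\<close>

lemma dual_objective_lambda_star:
  assumes "\<delta> \<ge> 0"
  shows "dual_objective N s \<delta> w (lambda_star N s w \<delta>) = nlp_objective N s \<delta> w"
proof -
  let ?f = "dual_objective N s \<delta> w"
  obtain l where l: "l \<in> {0..}" "nlp_objective N s \<delta> w = ?f l"
    using nlp_objective_attained by blast
  have "is_arg_min ?f (\<lambda>x. x \<in> {0..}) l"
    using l nlp_objective_le_dual_objective[OF assms, of _ N s w]
    by (auto simp: is_arg_min_linorder)
  hence "is_arg_min ?f (\<lambda>x. x \<in> {0..}) (lambda_star N s w \<delta>)"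
    unfolding lambda_star_def arg_min_on_def arg_min_def by (rule someI)
  hence "?f (lambda_star N s w \<delta>) \<le> ?f l" "lambda_star N s w \<delta> \<ge> 0"
    using l by (auto simp: is_arg_min_linorder)
  thus ?thesis
    using l nlp_objective_le_dual_objective[OF assms, of "lambda_star N s w \<delta>" N s w] by simp
qed

lemma v_w_eq_SUP_nlp_objective:
  "\<delta> \<ge> 0 \<Longrightarrow> v_w N s S\<^sub>0 \<delta> = (SUP w \<in> Gamma_w S\<^sub>0. ereal (nlp_objective N s \<delta> w))"
  unfolding v_w_def by (simp flip: dual_objective_lambda_star add: dual_objective_def)

text \<open>The cost is homogeneous of degree 0, and positive scaling preserves the signs in the
  indicators.\<close>

lemma nlp_objective_scaleR:
  assumes "c > 0"
  shows "nlp_objective N s \<delta> (c *\<^sub>R w) = nlp_objective N s \<delta> w"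
proof -
  have "cost s (c *\<^sub>R w) = cost s w"
    using assms by (auto simp: cost_def fun_eq_iff abs_mult)
  moreover have "(c *\<^sub>R w) \<bullet> s i \<ge> 0 \<longleftrightarrow> w \<bullet> s i \<ge> 0" "(c *\<^sub>R w) \<bullet> s i < 0 \<longleftrightarrow> w \<bullet> s i < 0" for i
    using assms by (simp_all add: zero_le_mult_iff mult_less_0_iff)
  ultimately show ?thesis
    by (simp only: nlp_objective_def nlp_indices_def nlp_F_def nlp_z_def nlp_lambda_def)
qed

text \<open>
  The jump of the indicators at \<open>w \<bullet> s\<^sub>i = 0\<close> is harmless because \<open>c\<^sub>i = 0\<close> there: both cases are
  covered by one continuous expression in the negative part of \<open>w \<bullet> s\<^sub>i\<close>.
\<close>

lemma continuous_on_dual_objective: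
  assumes "0 \<notin> K"
  shows "continuous_on K (\<lambda>w. dual_objective N s \<delta> w l)"
proof -
  have term_eq: "of_bool (w \<bullet> s i \<ge> 0) + of_bool (w \<bullet> s i < 0) * max (1 - l * cost s w i) 0
      = max (1 - l * (max 0 (- (w \<bullet> s i)) / norm w)) 0" for w i
    by (cases "w \<bullet> s i \<ge> 0") (auto simp: cost_def max_absorb1 max_absorb2)
  have dual: "dual_objective N s \<delta> w l
      = l * \<delta> + 1 / real N * (\<Sum>i=1..N. max (1 - l * (max 0 (- (w \<bullet> s i)) / norm w)) 0)" for w
    unfolding dual_objective_def K0_def K1_def term_eq[symmetric] sum.distrib distrib_left
    by (rule add.assoc)
  have "\<forall>w\<in>K. norm w \<noteq> 0" using assms by auto
  thus ?thesis unfolding dual by (intro continuous_intros)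
qed

section \<open>The outer maximum: feasible set and rescaling\<close>

lemma compact_nlp_feasible:
  fixes S\<^sub>0 :: "real ^ 'n"
  shows "compact (nlp_feasible S\<^sub>0 M \<epsilon>)"
proof -
  have "nlp_feasible S\<^sub>0 M \<epsilon> = {w. \<forall>j. \<bar>w $ j\<bar> \<le> M} \<inter> {w. w \<bullet> S\<^sub>0 = 0} \<inter>
      {w. (\<Sum>j\<in>UNIV. \<bar>w $ j\<bar>) \<ge> \<epsilon>}"
    by (auto simp: nlp_feasible_def)
  moreover have "closed {w::real^'n. \<forall>j. \<bar>w $ j\<bar> \<le> M}"
    by (intro closed_Collect_all closed_Collect_le continuous_intros)
  moreover have "closed {w. w \<bullet> S\<^sub>0 = 0}"
    by (intro closed_Collect_eq continuous_intros)
  moreover have "closed {w::real^'n. (\<Sum>j\<in>UNIV. \<bar>w $ j\<bar>) \<ge> \<epsilon>}"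
    by (intro closed_Collect_le continuous_intros)
  ultimately have "closed (nlp_feasible S\<^sub>0 M \<epsilon>)" by (auto intro: closed_Int)
  moreover have "bounded (nlp_feasible S\<^sub>0 M \<epsilon>)"
  proof (rule boundedI)
    fix w assume "w \<in> nlp_feasible S\<^sub>0 M \<epsilon>"
    hence "(\<Sum>j\<in>UNIV. \<bar>w $ j\<bar>) \<le> (\<Sum>j\<in>(UNIV::'n set). M)"
      by (intro sum_mono) (auto simp: nlp_feasible_def)
    thus "norm w \<le> (\<Sum>j\<in>(UNIV::'n set). M)" using norm_le_l1_cart[of w] by linarith
  qed
  ultimately show ?thesis by (simp add: compact_eq_bounded_closed)
qed

lemma nlp_feasible_subset_Gamma_w: "\<epsilon> > 0 \<Longrightarrow> nlp_feasible S\<^sub>0 M \<epsilon> \<subseteq> Gamma_w S\<^sub>0"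
  by (auto simp: nlp_feasible_def Gamma_w_def)

text \<open>At l1-norm exactly \<open>\<epsilon>\<close> the lower bound holds with equality, and
  every coordinate is at most \<open>\<epsilon> \<le> M\<close> in absolute value.\<close>

lemma Gamma_w_scales_to_nlp_feasible:
  assumes "0 < \<epsilon>" "\<epsilon> \<le> M" "w \<in> Gamma_w S\<^sub>0"
  shows "\<exists>c>0. c *\<^sub>R w \<in> nlp_feasible S\<^sub>0 M \<epsilon>"
proof -
  define t where "t = (\<Sum>j\<in>UNIV. \<bar>w $ j\<bar>)"
  have "norm w \<le> t" unfolding t_def by (rule norm_le_l1_cart)
  moreover have "norm w > 0" using assms by (simp add: Gamma_w_def)
  ultimately have t: "t > 0" by linarith
  have sum_eq: "(\<Sum>j\<in>UNIV. \<bar>((\<epsilon> / t) *\<^sub>R w) $ j\<bar>) = \<epsilon>"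
  proof -
    have "(\<Sum>j\<in>UNIV. \<bar>((\<epsilon> / t) *\<^sub>R w) $ j\<bar>) = \<epsilon> / t * t"
      unfolding t_def sum_distrib_left using assms t
      by (intro sum.cong) (auto simp: abs_mult sum_nonneg)
    thus ?thesis using t by simp
  qed
  have "\<bar>((\<epsilon> / t) *\<^sub>R w) $ j\<bar> \<le> M" for j
    using member_le_sum[of j UNIV "\<lambda>j. \<bar>((\<epsilon> / t) *\<^sub>R w) $ j\<bar>"] sum_eq assms by simp
  hence "(\<epsilon> / t) *\<^sub>R w \<in> nlp_feasible S\<^sub>0 M \<epsilon>"
    using sum_eq assms by (simp add: nlp_feasible_def Gamma_w_def)
  thus ?thesis using assms t by (intro exI[of _ "\<epsilon> / t"]) simp
qed

text \<open>The equality is exact for every \<open>0 < \<epsilon> \<le> M\<close>. Attainment is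
  conditional because \<open>Gamma_w\<close> can be empty, as in dimension one with nonzero initial
  price; both suprema are then minus infinity.\<close>

theorem theorem2p1:
  fixes S\<^sub>0 :: "real ^ 'n" and s :: "nat \<Rightarrow> real ^ 'n" and N :: nat and \<delta> M \<epsilon> :: real
  assumes "N \<ge> 1" and "\<delta> \<ge> 0" and "0 < \<epsilon>" and "\<epsilon> \<le> M"
  shows "v_w N s S\<^sub>0 \<delta> = (SUP w \<in> nlp_feasible S\<^sub>0 M \<epsilon>. ereal (nlp_objective N s \<delta> w)) \<and>
    (Gamma_w S\<^sub>0 \<noteq> {} \<longrightarrow>
      (\<exists>w \<in> nlp_feasible S\<^sub>0 M \<epsilon>.
        (\<forall>w' \<in> nlp_feasible S\<^sub>0 M \<epsilon>. nlp_objective N s \<delta> w' \<le> nlp_objective N s \<delta> w) \<and>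
        v_w N s S\<^sub>0 \<delta> = ereal (nlp_objective N s \<delta> w)))"
proof -
  let ?K = "nlp_feasible S\<^sub>0 M \<epsilon>" and ?g = "nlp_objective N s \<delta>"
  have "?g ` Gamma_w S\<^sub>0 \<subseteq> ?g ` ?K"
  proof
    fix x assume "x \<in> ?g ` Gamma_w S\<^sub>0"
    then obtain w where w: "w \<in> Gamma_w S\<^sub>0" "x = ?g w" by blast
    obtain c where "c > 0" "c *\<^sub>R w \<in> ?K"
      using Gamma_w_scales_to_nlp_feasible[OF assms(3,4) w(1)] by blast
    thus "x \<in> ?g ` ?K" using w(2) by (metis image_eqI nlp_objective_scaleR)
  qed
  hence "?g ` Gamma_w S\<^sub>0 = ?g ` ?K"
    using nlp_feasible_subset_Gamma_w[OF assms(3)] by blast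
  hence "(\<lambda>w. ereal (?g w)) ` Gamma_w S\<^sub>0 = (\<lambda>w. ereal (?g w)) ` ?K"
    by (metis image_image)
  hence v: "v_w N s S\<^sub>0 \<delta> = (SUP w \<in> ?K. ereal (?g w))"
    by (simp add: v_w_eq_SUP_nlp_objective[OF assms(2)])
  have "\<exists>w\<in>?K. (\<forall>w'\<in>?K. ?g w' \<le> ?g w) \<and> v_w N s S\<^sub>0 \<delta> = ereal (?g w)" if "Gamma_w S\<^sub>0 \<noteq> {}"
  proof -
    have "?K \<noteq> {}" using that Gamma_w_scales_to_nlp_feasible[OF assms(3,4)] by blast
    moreover have "0 \<notin> ?K" using nlp_feasible_subset_Gamma_w[OF assms(3)] by (auto simp: Gamma_w_def)
    \<comment> \<open>The family is indexed by the multiplier \<open>l\<close>, not by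
      \<open>k\<close>: for fixed \<open>l\<close> the dual objective is continuous off 0, whereas
      \<open>nlp_F\<close> at fixed \<open>k\<close> need not be continuous where
      \<open>cost s w k\<close> vanishes, and the index set changes there.\<close>
    ultimately obtain w where w: "w \<in> ?K" "\<And>w'. w' \<in> ?K \<Longrightarrow> ?g w' \<le> ?g w"
      using pointwise_min_attains_max[of ?K "{0..}" "\<lambda>l w. dual_objective N s \<delta> w l" ?g]
        compact_nlp_feasible continuous_on_dual_objective nlp_objective_attained
        nlp_objective_le_dual_objective[OF assms(2)]
      by (metis atLeast_iff)
    have "(SUP w \<in> ?K. ereal (?g w)) = ereal (?g w)"
      using w by (intro antisym SUP_least SUP_upper) auto
    thus ?thesis using w v by auto
  qed
  thus ?thesis using v by blast
qed

end
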